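(* Let $p\geqslant 1$ and let $h:\mathbb{R}^d\to\mathbb{R}$ be convex. For $a>0$ put $$F_a(x,y)=h(x-y)+a|x|^p-\frac1a|y|^p,\qquad x,y\in\mathbb{R}^d.$$ There exist $a>0$ and $b\in\mathbb{R}$ such that $F_a(x,y)\geqslant b$ for all $x,y\in\mathbb{R}^d$ if and only if there exist $A>0$ and $B\in\mathbb{R}$ such that $h(z)\geqslant A|z|^p-B$ for every $z\in\mathbb{R}^d$.
   Context: $|\cdot|$ denotes the Euclidean norm on $\mathbb{R}^d$. *)

theory Defs
  imports "HOL-Analysis.Analysis"
begin

text \<open>The exponent is real, hence powr; in HOL \<open>0 powr p = 0\<close>, which is the
  usual value of the power at the origin because \<open>p \<ge> 1\<close> below.\<close>

definition F :: "(real ^ 'n \<Rightarrow> real) \<Rightarrow> real \<Rightarrow> real \<Rightarrow> real ^ 'n \<Rightarrow> real ^ 'n \<Rightarrow> real"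
  where "F h p a x y = h (x - y) + a * norm x powr p - (1 / a) * norm y powr p"

end

theory Submission
  imports Defs
begin

text \<open>Setting x = 0 in a lower bound for F leaves only h and the negative term, which is the
  growth bound. Conversely, y = x - (x - y), so the triangle inequality and
  \<open>powr_add_le\<close> bound |y|^p by 2^p (|x - y|^p + |x|^p). After division by a large a,
  the |x - y|^p part is absorbed by the growth of h and the |x|^p part by a|x|^p.\<close>

lemma powr_add_le:
  fixes u v p :: real
  assumes "u \<ge> 0" "v \<ge> 0" "p \<ge> 0"
  shows "(u + v) powr p \<le> 2 powr p * (u powr p + v powr p)"
proof -
  \<comment> \<open>A sum is at most twice its larger term, and the power of the maximum is one of
    the two powers on the right.\<close>
  have "(u + v) powr p \<le> (2 * max u v) powr p"
    using assms by (intro powr_mono2) auto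
  also have "\<dots> = 2 powr p * max u v powr p"
    using assms by (intro powr_mult)
  also have "\<dots> \<le> 2 powr p * (u powr p + v powr p)"
    by (intro mult_left_mono) (auto simp: max_def)
  finally show ?thesis .
qed

theorem lemma1:
  fixes h :: "real ^ 'n \<Rightarrow> real" and p :: real
  assumes "p \<ge> 1" and "convex_on UNIV h"
  shows "(\<exists>a>0. \<exists>b::real. \<forall>x y. F h p a x y \<ge> b) \<longleftrightarrow>
         (\<exists>A>0. \<exists>B::real. \<forall>z. h z \<ge> A * norm z powr p - B)"
proof
  assume "\<exists>a>0. \<exists>b::real. \<forall>x y. F h p a x y \<ge> b"
  then obtain a b where a: "a > 0" and b: "\<And>x y. F h p a x y \<ge> b"
    by blast
  \<comment> \<open>At x = 0, y = -z the term a|x|^p vanishes, since \<open>0 powr p = 0\<close>,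
    and x - y = z.\<close>
  have "h z \<ge> (1 / a) * norm z powr p - (- b)" for z
    using b[of 0 "- z"] by (simp add: F_def)
  with a show "\<exists>A>0. \<exists>B::real. \<forall>z. h z \<ge> A * norm z powr p - B"
    by (intro exI[of _ "1 / a"] conjI exI[of _ "- b"]) auto
next
  assume "\<exists>A>0. \<exists>B::real. \<forall>z. h z \<ge> A * norm z powr p - B"
  then obtain A B where A: "A > 0" and B: "\<And>z. h z \<ge> A * norm z powr p - B"
    by blast
  define c :: real where "c = 2 powr p"
  \<comment> \<open>The final estimate needs c/a \<le> A and c/a \<le> a. The first is a \<ge> c/A;
    the second follows from a \<ge> c \<ge> 1, which gives c/a \<le> 1 \<le> a.\<close>
  define a where "a = max c (c / A)"
  have c: "c \<ge> 1"
    using assms(1) by (simp add: c_def ge_one_powr_ge_zero)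
  have a: "a \<ge> c" "c / A \<le> a"
    by (simp_all add: a_def)
  with c have "a > 0" by linarith
  have "c / a \<le> A"
    using a(2) A \<open>a > 0\<close> by (simp add: field_simps)
  have "c / a \<le> 1"
    using a(1) \<open>a > 0\<close> by simp
  with a(1) c have "c / a \<le> a" by linarith
  have "F h p a x y \<ge> - B" for x y
  proof -
    have "norm y \<le> norm (x - y) + norm x"
      by (metis add.commute norm_minus_commute norm_triangle_sub)
    then have "norm y powr p \<le> (norm (x - y) + norm x) powr p"
      using assms(1) by (intro powr_mono2) auto
    also have "\<dots> \<le> c * (norm (x - y) powr p + norm x powr p)"
      unfolding c_def using assms(1) by (intro powr_add_le) auto
    finally have "(1 / a) * norm y powr p \<le> c / a * norm (x - y) powr p + c / a * norm x powr p"
      using \<open>a > 0\<close> by (simp add: field_simps)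
    \<comment> \<open>The two requirements on a are used here, one for each summand; the bound on h
      at x - y then leaves just -B.\<close>
    also have "\<dots> \<le> A * norm (x - y) powr p + a * norm x powr p"
      using \<open>c / a \<le> A\<close> \<open>c / a \<le> a\<close> by (intro add_mono mult_right_mono) auto
    finally show ?thesis
      using B[of "x - y"] by (simp add: F_def)
  qed
  with \<open>a > 0\<close> show "\<exists>a>0. \<exists>b::real. \<forall>x y. F h p a x y \<ge> b"
    by blast
qed

end
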